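(* Let $T>0$, $h>0$, $N=\lfloor T/h\rfloor$, and let $(C^n)_{n\in\mathbb{N}}$ be nonempty closed convex subsets of $\mathbb{R}^d$, all contained in a fixed ball $B(0,M)$, and satisfying $\sum_{n=1}^N d_H(C^n,C^{n-1})^2/h<\infty$ with a bound that is uniform in $h$ for $h<h_0$. Let $(R_j)_{j\ge0}$ be the discrete kernel weights described in the context, and assume that $(R_j)_{j\in\mathbb{N}}$ is decreasing. Given past values $(X^{n})_{n<0}$ in $\mathbb{R}^d$ as described in the context, define successively for $n\ge0$ $$X^n:=\operatorname*{argmin}_{W\in C^n}\mathcal{E}_n(W),\qquad \mathcal{E}_n(W):=\frac h2\sum_{j\ge1}|W-X^{n-j}|^2R_j .$$ Then $$\mathcal{E}_N(X^N)+\sum_{n=0}^{N-1}D_n\le e^{2T}\mathcal{E}_0(X^0)+e^{2T}\sum_{n=0}^{N-1}\frac{e(C^n,C^{n+1})^2}{h},$$ where $D_n:=\frac h2\sum_{j\ge1}(R_j-R_{j+1})|X^n-X^{n-j}|^2\ge0$.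
   Context: $\varrho:\mathbb{R}_+\to\mathbb{R}_+$ is a Lipschitz kernel with $\int_0^\infty\varrho\,da=1$, $\int_0^\infty(1+a)^2\varrho(a)\,da<\infty$, $\partial_a\varrho\le0$ a.e., and $-\partial_a\varrho/\varrho\le\zeta$ a.e. for some $\zeta>0$ (so $\varrho>0$); its discrete weights are $R_j:=\frac1h\int_{jh}^{(j+1)h}\varrho(a)\,da$, $j\ge0$, so that $h\sum_{j\ge0}R_j=1$. The past values are $X^n=X_p(nh)$ for $n<0$, where $X_p:(-\infty,0)\to\mathbb{R}^d$ is a given Lipschitz function. $d_H$ is the Hausdorff distance, and $e(A,B):=\sup_{a\in A}\inf_{b\in B}|a-b|$ is the excess of $A$ over $B$. *)

theory Defs
  imports "HOL-Analysis.Analysis"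
begin

text \<open>Real-valued suprema and infima: meaningful for nonempty bounded sets, which are the only
  ones to which these functions are applied.\<close>

definition excess :: "'a::real_normed_vector set \<Rightarrow> 'a set \<Rightarrow> real" where
  "excess A B = (SUP a\<in>A. INF b\<in>B. norm (a - b))"

definition hausdorff_dist :: "'a::real_normed_vector set \<Rightarrow> 'a set \<Rightarrow> real" where
  "hausdorff_dist A B = max (excess A B) (excess B A)"

definition kernel_weight :: "(real \<Rightarrow> real) \<Rightarrow> real \<Rightarrow> nat \<Rightarrow> real" where
  "kernel_weight \<rho> h j = (1 / h) * (LBINT a:{real j * h..real (j + 1) * h}. \<rho> a)"

text \<open>In both series below the summation index \<open>j \<ge> 1\<close> is written \<open>Suc j\<close> with \<open>j \<ge> 0\<close>.
  Trajectories are indexed by \<open>int\<close>, negative indices being the past.\<close>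

definition memory_energy ::
  "real \<Rightarrow> (nat \<Rightarrow> real) \<Rightarrow> (int \<Rightarrow> 'a::real_normed_vector) \<Rightarrow> int \<Rightarrow> 'a \<Rightarrow> real" where
  "memory_energy h R X n W =
     h / 2 * (\<Sum>j. (norm (W - X (n - int (Suc j))))\<^sup>2 * R (Suc j))"

definition memory_dissipation ::
  "real \<Rightarrow> (nat \<Rightarrow> real) \<Rightarrow> (int \<Rightarrow> 'a::real_normed_vector) \<Rightarrow> int \<Rightarrow> real" where
  "memory_dissipation h R X n =
     h / 2 * (\<Sum>j. (R (Suc j) - R (Suc (Suc j))) * (norm (X n - X (n - int (Suc j))))\<^sup>2)"

text \<open>The energy at step \<open>n\<close> only sees the trajectory before \<open>n\<close>; this is what makes the
  recursion defining the scheme terminate.\<close>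

lemma memory_energy_cong [fundef_cong]:
  assumes "h = h'" "R = R'" "n = n'"
    and "\<And>j. X (n' - int (Suc j)) = X' (n' - int (Suc j))"
  shows "memory_energy h R X n = memory_energy h' R' X' n'"
  using assms by (simp add: memory_energy_def fun_eq_iff)

text \<open>\<open>arg_min_on\<close> selects some minimiser; since the energy is a strictly convex quadratic function
  of its last argument whenever the weights are those of a positive kernel, there is only one on a
  nonempty compact convex set.\<close>

function memory_scheme ::
  "real \<Rightarrow> (nat \<Rightarrow> real) \<Rightarrow> (real \<Rightarrow> 'a::real_normed_vector) \<Rightarrow> (nat \<Rightarrow> 'a set) \<Rightarrow> int \<Rightarrow> 'a" where
  "memory_scheme h R Xp C n =
     (if n < 0 then Xp (real_of_int n * h)
      else arg_min_on (memory_energy h R (memory_scheme h R Xp C) n) (C (nat n)))"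
  by pat_completeness auto
termination
  by (relation "Wellfounded.measure (\<lambda>(h, R, Xp, C, n). nat (n + 1))") auto

declare memory_scheme.simps [simp del]

end

theory Submission
  imports Defs
begin

text \<open>Testing the minimality of \<open>X\<^sup>n\<^sup>+\<^sup>1\<close> against the point \<open>W\<close> of \<open>C\<^sup>n\<^sup>+\<^sup>1\<close> closest to \<open>X\<^sup>n\<close>
  suffices. Shifting the memory by one step gives \<open>E\<^sub>n\<^sub>+\<^sub>1(X\<^sup>n) = E\<^sub>n(X\<^sup>n) - D\<^sub>n\<close>, and replacing \<open>X\<^sup>n\<close>
  by \<open>W\<close> costs, by Young's inequality with parameter \<open>\<epsilon> = e\<^sup>2\<^sup>h - 1\<close> and since the weights have
  total mass at most \<open>1\<close>, a factor \<open>e\<^sup>2\<^sup>h\<close> plus \<open>(1 + 1/\<epsilon>)/2\<close> times the squared excess. With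
  this \<open>\<epsilon>\<close>, rather than \<open>\<epsilon> = h\<close>, no smallness of \<open>h\<close> is needed, because \<open>e\<^sup>2\<^sup>h - 1 \<ge> 2h\<close>.
  A discrete Gronwall argument concludes.\<close>

section \<open>Young's inequality, closest points and minimisers\<close>

text \<open>After the triangle inequality, the cross term \<open>2 * norm a * norm b\<close> is
  absorbed by expanding the square of \<open>sqrt e * norm a - norm b / sqrt e\<close>.\<close>

lemma power2_norm_add_le:
  fixes a b :: "'a::real_normed_vector"
  assumes "0 < e"
  shows "(norm (a + b))\<^sup>2 \<le> (1 + e) * (norm a)\<^sup>2 + (1 + 1 / e) * (norm b)\<^sup>2"
proof -
  have "(norm (a + b))\<^sup>2 \<le> (norm a + norm b)\<^sup>2"
    by (simp add: norm_triangle_ineq power_mono)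
  moreover have "0 \<le> (sqrt e * norm a - norm b / sqrt e)\<^sup>2"
    by simp
  ultimately show ?thesis
    using assms by (simp add: power2_sum power2_diff power_mult_distrib power_divide distrib_right)
qed

text \<open>A closed nonempty set in Euclidean space attains its distance to a point. Boundedness of
  \<open>A\<close> makes the real-valued supremum in \<open>excess\<close> a genuine upper
  bound.\<close>

lemma norm_le_excess:
  fixes A B :: "'a::euclidean_space set"
  assumes "bounded A" "closed B" "B \<noteq> {}" "x \<in> A"
  obtains y where "y \<in> B" "norm (y - x) \<le> excess A B"
proof -
  obtain y where y: "y \<in> B" "infdist x B = dist x y"
    using infdist_attains_inf[OF assms(2,3)] by metis
  obtain K where K: "\<And>a. a \<in> A \<Longrightarrow> norm a \<le> K"
    using assms(1) unfolding bounded_iff by blast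
  \<comment> \<open>Nonemptiness matters here: \<open>infdist\<close> has the default value 0 on the
    empty set.\<close>
  have inf: "(INF b\<in>B. norm (a - b)) = infdist a B" for a
    using assms(3) by (simp add: infdist_notempty dist_norm)
  \<comment> \<open>One fixed competitor \<open>y\<close> bounds all these distances at
    once.\<close>
  have "infdist a B \<le> K + norm y" if "a \<in> A" for a
    using infdist_le[OF y(1), of a] K[OF that] norm_triangle_ineq4[of a y]
    by (simp add: dist_norm)
  then have "bdd_above ((\<lambda>a. infdist a B) ` A)"
    by (intro bdd_aboveI2)
  then have "infdist x B \<le> excess A B"
    unfolding excess_def inf using assms(4) by (intro cSUP_upper)
  with y that show thesis
    by (metis dist_norm norm_minus_commute)
qed

text \<open>\<open>arg_min_on\<close> is a choice operator, so it has the expected properties once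
  some minimiser exists; compactness and continuity supply one.\<close>

lemma arg_min_on_compact:
  fixes f :: "'a::topological_space \<Rightarrow> real"
  assumes "compact S" "S \<noteq> {}" "continuous_on S f"
  shows "arg_min_on f S \<in> S" and "\<And>y. y \<in> S \<Longrightarrow> f (arg_min_on f S) \<le> f y"
proof -
  obtain x where "x \<in> S" "\<forall>y\<in>S. f x \<le> f y"
    using continuous_attains_inf[OF assms] by blast
  then have "is_arg_min f (\<lambda>x. x \<in> S) x"
    by (simp add: is_arg_min_linorder)
  then have "is_arg_min f (\<lambda>x. x \<in> S) (arg_min_on f S)"
    unfolding arg_min_on_def arg_min_def by (rule someI)
  then show "arg_min_on f S \<in> S" "\<And>y. y \<in> S \<Longrightarrow> f (arg_min_on f S) \<le> f y"
    by (simp_all add: is_arg_min_linorder)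
qed

section \<open>Mass and second moment of the discrete weights\<close>

text \<open>Neighbouring closed cells share only an endpoint, a null set, so the integrals add up to
  the one over \<open>{0..real n * h}\<close>; nonnegativity then allows the domain to grow.\<close>

lemma set_integral_grid_sum_le:
  fixes f :: "real \<Rightarrow> real"
  assumes int: "set_integrable lborel {0..} f" and nonneg: "\<And>a. 0 \<le> a \<Longrightarrow> 0 \<le> f a" and "0 < h"
  shows "(\<Sum>j<n. LBINT a:{real j * h..real (j + 1) * h}. f a) \<le> (LBINT a:{0..}. f a)"
proof -
  have sub: "set_integrable lborel S f" if "S \<in> sets lborel" "S \<subseteq> {0..}" for S
    using set_integrable_subset[OF int that] .
  have "(\<Sum>j<n. LBINT a:{real j * h..real (j + 1) * h}. f a) = (LBINT a:{0..real n * h}. f a)"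
  proof (induction n)
    case 0
    \<comment> \<open>The empty sum faces the degenerate interval consisting of the point 0, which
      is null.\<close>
    have "AE a in lborel. indicator {0..0::real} a *\<^sub>R f a = 0"
      using AE_lborel_singleton[of "0::real"] by eventually_elim auto
    then show ?case
      by (simp add: set_lebesgue_integral_def integral_eq_zero_AE)
  next
    case (Suc n)
    have split: "{0..real (Suc n) * h} = {0..real n * h} \<union> {real n * h..real (n + 1) * h}"
      using \<open>0 < h\<close> by (subst ivl_disj_un_two_touch) (auto simp: mult_right_mono)
    have "AE a in lborel. \<not> (a \<in> {0..real n * h} \<and> a \<in> {real n * h..real (n + 1) * h})"
      using AE_lborel_singleton[of "real n * h"] by eventually_elim auto
    moreover have "{real n * h..real (n + 1) * h} \<subseteq> {0..}"
      using \<open>0 < h\<close> by (auto intro: order_trans[rotated])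
    ultimately have "(LBINT a:{0..real (Suc n) * h}. f a)
        = (LBINT a:{0..real n * h}. f a) + (LBINT a:{real n * h..real (n + 1) * h}. f a)"
      unfolding split by (intro set_integral_Un_AE sub) auto
    then show ?case
      using Suc.IH by simp
  qed
  also have "\<dots> \<le> (LBINT a:{0..}. f a)"
    unfolding set_lebesgue_integral_def
    using sub[of "{0..real n * h}"] int nonneg
    by (intro integral_mono) (auto simp: set_integrable_def indicator_def)
  finally show ?thesis .
qed

lemma kernel_weight_nonneg:
  assumes "\<And>a. 0 \<le> a \<Longrightarrow> 0 \<le> \<rho> a" "0 < h"
  shows "0 \<le> kernel_weight \<rho> h j"
proof -
  have "0 \<le> (LBINT a:{real j * h..real (j + 1) * h}. \<rho> a)"
    unfolding set_lebesgue_integral_def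
  proof (intro Bochner_Integration.integral_nonneg)
    fix a :: real
    have "0 \<le> real j * h"
      using \<open>0 < h\<close> by simp
    then show "0 \<le> indicator {real j * h..real (j + 1) * h} a *\<^sub>R \<rho> a"
      using assms(1)[of a] by (cases "a \<ge> 0") (auto simp: indicator_def)
  qed
  then show ?thesis
    using \<open>0 < h\<close> by (simp add: kernel_weight_def)
qed

lemma kernel_weight_sum_le:
  assumes "set_integrable lborel {0..} \<rho>" "\<And>a. 0 \<le> a \<Longrightarrow> 0 \<le> \<rho> a" "0 < h"
  shows "h * (\<Sum>j<n. kernel_weight \<rho> h j) \<le> (LBINT a:{0..}. \<rho> a)"
  using set_integral_grid_sum_le[OF assms] assms(3)
  by (simp add: kernel_weight_def sum_divide_distrib[symmetric])

text \<open>On its cell, \<open>real j * h\<close> is the left endpoint, so the discrete quadratic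
  factor is below \<open>(1 + a)\<^sup>2\<close>. This moment controls a past that grows
  linearly.\<close>

lemma kernel_weight_moment_summable:
  assumes int: "set_integrable lborel {0..} \<rho>"
    and moment: "set_integrable lborel {0..} (\<lambda>a. (1 + a)\<^sup>2 * \<rho> a)"
    and nonneg: "\<And>a. 0 \<le> a \<Longrightarrow> 0 \<le> \<rho> a" and "0 < h"
  shows "summable (\<lambda>j. (1 + real j * h)\<^sup>2 * kernel_weight \<rho> h j)"
proof (rule bounded_imp_summable)
  show "0 \<le> (1 + real j * h)\<^sup>2 * kernel_weight \<rho> h j" for j
    using kernel_weight_nonneg[OF nonneg \<open>0 < h\<close>] by simp
  fix n
  have "(1 + real j * h)\<^sup>2 * kernel_weight \<rho> h j
      \<le> (LBINT a:{real j * h..real (j + 1) * h}. (1 + a)\<^sup>2 * \<rho> a) / h" for j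
  proof -
    let ?I = "{real j * h..real (j + 1) * h}"
    have pos: "0 \<le> real j * h"
      using \<open>0 < h\<close> by simp
    then have sub: "?I \<subseteq> {0..}"
      by auto
    have "(LBINT a:?I. (1 + real j * h)\<^sup>2 * \<rho> a) \<le> (LBINT a:?I. (1 + a)\<^sup>2 * \<rho> a)"
    proof (rule set_integral_mono)
      show "set_integrable lborel ?I (\<lambda>a. (1 + real j * h)\<^sup>2 * \<rho> a)"
        using set_integrable_subset[OF int _ sub] by simp
      show "set_integrable lborel ?I (\<lambda>a. (1 + a)\<^sup>2 * \<rho> a)"
        using set_integrable_subset[OF moment _ sub] by simp
      show "(1 + real j * h)\<^sup>2 * \<rho> a \<le> (1 + a)\<^sup>2 * \<rho> a" if "a \<in> ?I" for a
        using that pos nonneg[of a] by (intro mult_right_mono power_mono) auto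
    qed
    then show ?thesis
      using \<open>0 < h\<close> by (simp add: kernel_weight_def divide_right_mono)
  qed
  then have "(\<Sum>j<Suc n. (1 + real j * h)\<^sup>2 * kernel_weight \<rho> h j)
      \<le> (\<Sum>j<Suc n. LBINT a:{real j * h..real (j + 1) * h}. (1 + a)\<^sup>2 * \<rho> a) / h"
    unfolding sum_divide_distrib by (rule sum_mono)
  also have "\<dots> \<le> (LBINT a:{0..}. (1 + a)\<^sup>2 * \<rho> a) / h"
    using set_integral_grid_sum_le[OF moment _ \<open>0 < h\<close>, of "Suc n"] nonneg \<open>0 < h\<close>
    by (intro divide_right_mono) auto
  finally show "(\<Sum>j\<le>n. (1 + real j * h)\<^sup>2 * kernel_weight \<rho> h j)
      \<le> (LBINT a:{0..}. (1 + a)\<^sup>2 * \<rho> a) / h"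
    by (simp add: lessThan_Suc_atMost)
qed

section \<open>Convergence and continuity of the energy\<close>

text \<open>Linear growth of the past, squared, is matched by the second moment of the weights. The
  resulting majorant is uniform for arguments in a ball, so the Weierstrass M-test gives
  continuity.\<close>

lemma memory_energy_summable:
  fixes X :: "int \<Rightarrow> 'a::real_normed_vector"
  assumes nonneg: "\<And>j. 0 \<le> R j"
    and moment: "summable (\<lambda>j. (1 + real j * h)\<^sup>2 * R j)"
    and growth: "\<And>j. norm (X (n - int (Suc j))) \<le> K * (1 + real (Suc j) * h)"
    and "0 < h"
  shows "summable (\<lambda>j. (norm (W - X (n - int (Suc j))))\<^sup>2 * R (Suc j))"
    and "continuous_on (cball 0 M) (memory_energy h R X n)"
proof -
  \<comment> \<open>\<open>r\<close> bounds the norm of the argument; the factor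
    \<open>r + K\<close> comes from \<open>r + K * s \<le> (r + K) * s\<close> for
    \<open>s \<ge> 1\<close> and \<open>r \<ge> 0\<close>.\<close>
  define B where "B r j = (r + K)\<^sup>2 * ((1 + real (Suc j) * h)\<^sup>2 * R (Suc j))" for r j
  have B: "summable (B r)" for r
    unfolding B_def using moment by (intro summable_mult) (subst summable_Suc_iff)
  have le: "norm ((norm (V - X (n - int (Suc j))))\<^sup>2 * R (Suc j)) \<le> B r j" if "norm V \<le> r" for V r j
  proof -
    have "0 \<le> r"
      using that norm_ge_zero[of V] by linarith
    then have "r * 1 \<le> r * (1 + real (Suc j) * h)"
      using \<open>0 < h\<close> by (intro mult_left_mono) auto
    then have "norm (V - X (n - int (Suc j))) \<le> (r + K) * (1 + real (Suc j) * h)"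
      using norm_triangle_ineq4[of V "X (n - int (Suc j))"] that growth[of j]
      unfolding distrib_right by linarith
    then have "(norm (V - X (n - int (Suc j))))\<^sup>2 \<le> (r + K)\<^sup>2 * (1 + real (Suc j) * h)\<^sup>2"
      unfolding power_mult_distrib[symmetric] by (intro power_mono) auto
    then show ?thesis
      using mult_right_mono[OF _ nonneg[of "Suc j"]] nonneg[of "Suc j"]
      unfolding B_def by (simp add: mult.assoc[symmetric])
  qed
  show "summable (\<lambda>j. (norm (W - X (n - int (Suc j))))\<^sup>2 * R (Suc j))"
    by (rule summable_comparison_test'[OF B[of "norm W"]]) (rule le, simp)
  have "uniform_limit (cball 0 M)
      (\<lambda>k V. \<Sum>j<k. (norm (V - X (n - int (Suc j))))\<^sup>2 * R (Suc j))
      (\<lambda>V. \<Sum>j. (norm (V - X (n - int (Suc j))))\<^sup>2 * R (Suc j)) sequentially"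
    by (rule Weierstrass_m_test[OF _ B[of M]]) (rule le, simp)
  then have "continuous_on (cball 0 M) (\<lambda>V. \<Sum>j. (norm (V - X (n - int (Suc j))))\<^sup>2 * R (Suc j))"
    by (rule uniform_limit_theorem[rotated]) (auto intro!: always_eventually continuous_intros)
  then show "continuous_on (cball 0 M) (memory_energy h R X n)"
    unfolding memory_energy_def by (intro continuous_intros)
qed

text \<open>Lipschitz data grow at most linearly, and only finitely many values have been computed
  before step \<open>n\<close>. The constant may depend on \<open>n\<close>.\<close>

lemma memory_scheme_growth:
  fixes X\<^sub>p :: "real \<Rightarrow> 'a::real_normed_vector"
  assumes "L-lipschitz_on {..<0} X\<^sub>p" and "0 < h"
  shows "\<exists>K. \<forall>j. norm (memory_scheme h R X\<^sub>p C (int n - int (Suc j))) \<le> K * (1 + real (Suc j) * h)"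
proof -
  let ?X = "memory_scheme h R X\<^sub>p C"
  \<comment> \<open>The summands bound the computed values, the most recent past value and the slope
    of the past. The anchor is \<open>- h\<close> because \<open>X\<^sub>p\<close> is controlled
    only on negative times, and every past grid time is at most \<open>- h\<close>.\<close>
  define A where "A = (\<Sum>i<n. norm (?X (int i))) + norm (X\<^sub>p (- h)) + L"
  have "0 \<le> L"
    using assms(1) by (rule lipschitz_on_nonneg)
  have S: "0 \<le> (\<Sum>i<n. norm (?X (int i)))"
    by (simp add: sum_nonneg)
  have "0 \<le> A"
    unfolding A_def using S \<open>0 \<le> L\<close> by simp
  have "norm (?X (int n - int (Suc j))) \<le> A * (1 + real (Suc j) * h)" for j
  proof (cases "int n - int (Suc j) < 0")
    case True
    define t where "t = real_of_int (int n - int (Suc j)) * h"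
    have "t \<le> (- 1) * h"
      unfolding t_def using True \<open>0 < h\<close> by (intro mult_right_mono) linarith+
    moreover have "t \<ge> (- real (Suc j)) * h"
      unfolding t_def using \<open>0 < h\<close> by (intro mult_right_mono) auto
    ultimately have t: "t \<le> - h" "- t \<le> real (Suc j) * h"
      by (simp_all only: mult_minus_left mult_1 minus_le_iff)
    have "norm (X\<^sub>p t) \<le> norm (X\<^sub>p (- h)) + dist (X\<^sub>p t) (X\<^sub>p (- h))"
      using norm_triangle_sub[of "X\<^sub>p t" "X\<^sub>p (- h)"] by (simp add: dist_norm)
    also have "dist (X\<^sub>p t) (X\<^sub>p (- h)) \<le> L * dist t (- h)"
      using assms t by (intro lipschitz_onD[OF assms(1)]) auto
    also have "L * dist t (- h) \<le> L * (real (Suc j) * h)"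
      using t \<open>0 \<le> L\<close> \<open>0 < h\<close> by (intro mult_left_mono) (auto simp: dist_real_def)
    also have "norm (X\<^sub>p (- h)) + L * (real (Suc j) * h) \<le> A * 1 + A * (real (Suc j) * h)"
      using S \<open>0 \<le> L\<close> \<open>0 < h\<close> unfolding A_def by (intro add_mono mult_right_mono) auto
    also have "\<dots> = A * (1 + real (Suc j) * h)"
      by (simp add: algebra_simps)
    finally show ?thesis
      using True unfolding t_def by (subst memory_scheme.simps) simp
  next
    case False
    define i where "i = n - Suc j"
    have i: "int n - int (Suc j) = int i" "i < n"
      using False unfolding i_def by auto
    have "norm (?X (int i)) \<le> (\<Sum>i<n. norm (?X (int i)))"
      using i by (intro member_le_sum) auto
    also have "\<dots> \<le> A"
      using \<open>0 \<le> L\<close> by (simp add: A_def)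
    also have "\<dots> \<le> A * (1 + real (Suc j) * h)"
      using \<open>0 \<le> A\<close> \<open>0 < h\<close> by (simp add: mult_le_cancel_left1)
    finally show ?thesis
      using i by simp
  qed
  then show ?thesis
    by blast
qed

section \<open>One-step energy relations\<close>

lemma memory_dissipation_nonneg:
  assumes "decseq R" "\<And>j. 0 \<le> R j" "0 < h"
    and summable: "summable (\<lambda>j. (norm (X n - X (n - int (Suc j))))\<^sup>2 * R (Suc j))"
  shows "0 \<le> memory_dissipation h R X n"
proof -
  have dec: "R (Suc (Suc j)) \<le> R (Suc j)" for j
    using assms(1) by (simp add: decseq_Suc_iff)
  \<comment> \<open>Termwise signs pass to \<open>suminf\<close> only for a convergent series; the
    energy series dominates this one.\<close>
  have "summable (\<lambda>j. (R (Suc j) - R (Suc (Suc j))) * (norm (X n - X (n - int (Suc j))))\<^sup>2)"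
  proof (rule summable_comparison_test'[OF summable])
    show "norm ((R (Suc j) - R (Suc (Suc j))) * (norm (X n - X (n - int (Suc j))))\<^sup>2)
        \<le> (norm (X n - X (n - int (Suc j))))\<^sup>2 * R (Suc j)" for j
      using dec[of j] assms(2)[of "Suc (Suc j)"]
      by (simp add: abs_mult mult.commute[of _ "R (Suc j)"] mult_right_mono)
  qed
  then have "0 \<le> (\<Sum>j. (R (Suc j) - R (Suc (Suc j))) * (norm (X n - X (n - int (Suc j))))\<^sup>2)"
    using dec by (intro suminf_nonneg) auto
  then show ?thesis
    using \<open>0 < h\<close> by (simp add: memory_dissipation_def)
qed

text \<open>At step \<open>n + 1\<close> the most recent memory point is \<open>X n\<close> itself,
  so its term vanishes. Every older point keeps its distance to \<open>X n\<close> but has its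
  weight index raised by one; the lost weight is the dissipation.\<close>

lemma memory_energy_shift:
  assumes "decseq R" "\<And>j. 0 \<le> R j"
    and summable: "summable (\<lambda>j. (norm (X n - X (n - int (Suc j))))\<^sup>2 * R (Suc j))"
  shows "memory_energy h R X (n + 1) (X n) = memory_energy h R X n (X n) - memory_dissipation h R X n"
proof -
  define a where "a j = (norm (X n - X (n - int (Suc j))))\<^sup>2" for j
  define f where "f j = (norm (X n - X (n + 1 - int (Suc j))))\<^sup>2 * R (Suc j)" for j
  have "n + 1 - int (Suc (Suc j)) = n - int (Suc j)" for j
    by simp
  then have f: "f 0 = 0" "f (Suc j) = a j * R (Suc (Suc j))" for j
    unfolding f_def a_def by (simp, simp only:)
  have s1: "summable (\<lambda>j. a j * R (Suc j))"
    using summable by (simp add: a_def)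
  have s2: "summable (\<lambda>j. a j * R (Suc (Suc j)))"
    by (rule summable_comparison_test'[OF s1])
      (use assms(1,2) in \<open>auto simp: a_def abs_mult decseq_Suc_iff intro: mult_left_mono\<close>)
  then have "summable f"
    using f(2) by (subst summable_Suc_iff[symmetric]) simp
  then have "suminf f = (\<Sum>j. a j * R (Suc (Suc j)))"
    using suminf_split_head[of f] f by simp
  also have "\<dots> = (\<Sum>j. a j * R (Suc j)) - (\<Sum>j. a j * R (Suc j) - a j * R (Suc (Suc j)))"
    using suminf_diff[OF s1 s2] by simp
  finally have "suminf f = (\<Sum>j. a j * R (Suc j)) - (\<Sum>j. (R (Suc j) - R (Suc (Suc j))) * a j)"
    by (simp add: algebra_simps)
  then show ?thesis
    unfolding memory_energy_def memory_dissipation_def f_def a_def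
    by (simp only: right_diff_distrib)
qed

text \<open>Young's inequality is applied to each \<open>W - X = (V - X) + (W - V)\<close>. The
  second summand does not depend on the memory index, so its weights sum to at most
  \<open>1 / h\<close>.\<close>

lemma memory_energy_perturb:
  assumes nonneg: "\<And>j. 0 \<le> R j" and "0 < h" and "0 < e"
    and mass: "summable R" "h * (\<Sum>j. R (Suc j)) \<le> 1"
    and summable: "\<And>V. summable (\<lambda>j. (norm (V - X (n - int (Suc j))))\<^sup>2 * R (Suc j))"
  shows "memory_energy h R X n W
    \<le> (1 + e) * memory_energy h R X n V + (1 + 1 / e) / 2 * (norm (W - V))\<^sup>2"
proof -
  let ?f = "\<lambda>V j. (norm (V - X (n - int (Suc j))))\<^sup>2 * R (Suc j)"
  let ?c = "(1 + 1 / e) * (norm (W - V))\<^sup>2"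
  have R: "summable (\<lambda>j. R (Suc j))"
    using mass(1) by (subst summable_Suc_iff)
  have "?f W j \<le> (1 + e) * ?f V j + ?c * R (Suc j)" for j
    using mult_right_mono[OF power2_norm_add_le[OF \<open>0 < e\<close>, of "V - X (n - int (Suc j))" "W - V"] nonneg]
    by (simp add: distrib_right mult.assoc)
  then have "suminf (?f W) \<le> (\<Sum>j. (1 + e) * ?f V j + ?c * R (Suc j))"
    by (intro suminf_le summable summable_add summable_mult R)
  also have "\<dots> = (1 + e) * suminf (?f V) + ?c * (\<Sum>j. R (Suc j))"
    by (simp only: suminf_add[symmetric] suminf_mult summable R summable_mult)
  finally have "h / 2 * suminf (?f W) \<le> h / 2 * ((1 + e) * suminf (?f V) + ?c * (\<Sum>j. R (Suc j)))"
    using \<open>0 < h\<close> by (intro mult_left_mono) auto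
  also have "\<dots> = (1 + e) * (h / 2 * suminf (?f V)) + ?c / 2 * (h * (\<Sum>j. R (Suc j)))"
    by (simp only: distrib_left times_divide_eq_left times_divide_eq_right mult.assoc mult.commute mult.left_commute)
  also have "\<dots> \<le> (1 + e) * (h / 2 * suminf (?f V)) + ?c / 2 * 1"
    using mass(2) \<open>0 < e\<close> by (intro add_left_mono mult_left_mono) auto
  finally show ?thesis
    by (simp add: memory_energy_def)
qed

section \<open>Discrete Gronwall argument and the energy estimate\<close>

lemma discrete_gronwall_dissipation:
  fixes E D c :: "nat \<Rightarrow> real"
  assumes step: "\<And>n. E (Suc n) \<le> q * (E n - D n + c n)"
    and "1 \<le> q" "\<And>n. 0 \<le> D n" "\<And>n. 0 \<le> c n"
  shows "E n + (\<Sum>k<n. D k) \<le> q ^ n * (E 0 + (\<Sum>k<n. c k))"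
proof (induction n)
  case 0
  then show ?case by simp
next
  case (Suc n)
  \<comment> \<open>Inflating the accumulated dissipation by \<open>q \<ge> 1\<close> makes the new
    \<open>q * D n\<close> cancel the one in the step inequality.\<close>
  have "E (Suc n) + (\<Sum>k<Suc n. D k) \<le> q * (E n - D n + c n) + 1 * (\<Sum>k<Suc n. D k)"
    using step[of n] by simp
  also have "\<dots> \<le> q * (E n - D n + c n) + q * (\<Sum>k<Suc n. D k)"
    using assms by (intro add_left_mono mult_right_mono sum_nonneg) auto
  also have "\<dots> = q * (E n + (\<Sum>k<n. D k)) + q * c n"
    by (simp add: algebra_simps)
  also have "\<dots> \<le> q * (q ^ n * (E 0 + (\<Sum>k<n. c k))) + q * (q ^ n * c n)"
    using Suc.IH assms(2) mult_right_mono[OF one_le_power[OF assms(2)] assms(4), of n n]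
    by (intro add_mono mult_left_mono) auto
  also have "\<dots> = q ^ Suc n * (E 0 + (\<Sum>k<Suc n. c k))"
    by (simp add: algebra_simps)
  finally show ?case .
qed

text \<open>The constraint sets are indexed by the mesh size as well, so that the variation bound
  can be stated uniformly in it; the estimate concerns the single mesh \<open>h\<close>.\<close>

theorem proposition3:
  fixes \<rho> :: "real \<Rightarrow> real"
    and \<zeta> T h h\<^sub>0 M :: real
    and X\<^sub>p :: "real \<Rightarrow> real ^ 'd"
    and C :: "real \<Rightarrow> nat \<Rightarrow> (real ^ 'd) set"
    and N :: nat
    and R :: "nat \<Rightarrow> real"
    and X :: "int \<Rightarrow> real ^ 'd"
  assumes kernel_nonneg: "\<forall>a\<ge>0. 0 \<le> \<rho> a"
    and kernel_lipschitz: "\<exists>L. L-lipschitz_on {0..} \<rho>"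
    and kernel_mass: "set_integrable lborel {0..} \<rho>" "(LBINT a:{0..}. \<rho> a) = 1"
    and kernel_moment: "set_integrable lborel {0..} (\<lambda>a. (1 + a)\<^sup>2 * \<rho> a)"
    and kernel_decreasing: "AE a in lborel. 0 < a \<longrightarrow> deriv \<rho> a \<le> 0"
    and kernel_log_deriv: "0 < \<zeta>"
      "AE a in lborel. 0 < a \<longrightarrow> 0 < \<rho> a \<and> - deriv \<rho> a / \<rho> a \<le> \<zeta>"
    and past_lipschitz: "\<exists>L. L-lipschitz_on {..<0} X\<^sub>p"
    and "0 < T" and "0 < h" and "0 < h\<^sub>0"
    and constraint_sets: "\<forall>\<eta>>0. \<forall>n.
      C \<eta> n \<noteq> {} \<and> closed (C \<eta> n) \<and> convex (C \<eta> n) \<and> C \<eta> n \<subseteq> cball 0 M"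
    and constraint_variation: "\<exists>K. \<forall>\<eta>. 0 < \<eta> \<and> \<eta> < h\<^sub>0 \<longrightarrow>
      (\<Sum>n = 1..nat \<lfloor>T / \<eta>\<rfloor>. (hausdorff_dist (C \<eta> n) (C \<eta> (n - 1)))\<^sup>2 / \<eta>) \<le> K"
    and N_eq: "N = nat \<lfloor>T / h\<rfloor>"
    and R_eq: "R = kernel_weight \<rho> h"
    and X_eq: "X = memory_scheme h R X\<^sub>p (C h)"
    and weights_decreasing: "decseq R"
  shows "memory_energy h R X (int N) (X (int N)) + (\<Sum>n<N. memory_dissipation h R X (int n))
           \<le> exp (2 * T) * memory_energy h R X 0 (X 0)
             + exp (2 * T) * (\<Sum>n<N. (excess (C h n) (C h (Suc n)))\<^sup>2 / h)
         \<and> (\<forall>n. 0 \<le> memory_dissipation h R X (int n))"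
proof -
  have nonneg: "0 \<le> R j" for j
    unfolding R_eq using kernel_nonneg \<open>0 < h\<close> by (intro kernel_weight_nonneg) auto
  have moment: "summable (\<lambda>j. (1 + real j * h)\<^sup>2 * R j)"
    unfolding R_eq using kernel_nonneg \<open>0 < h\<close> kernel_mass kernel_moment
    by (intro kernel_weight_moment_summable) auto
  have partial: "(\<Sum>j<n. R j) \<le> 1 / h" for n
    using kernel_weight_sum_le[OF kernel_mass(1), of h n] kernel_nonneg \<open>0 < h\<close> kernel_mass(2)
    unfolding R_eq by (simp add: field_simps)
  have "summable R"
    using nonneg partial[of "Suc _"] by (intro bounded_imp_summable[of R "1 / h"])
      (auto simp: lessThan_Suc_atMost)
  \<comment> \<open>The energy starts at weight index 1, so dropping \<open>R 0\<close> leaves mass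
    at most 1.\<close>
  have "(\<Sum>j. R (Suc j)) \<le> suminf R"
    using suminf_split_head[OF \<open>summable R\<close>] nonneg[of 0] by simp
  also have "\<dots> \<le> 1 / h"
    using \<open>summable R\<close> partial by (rule suminf_le_const)
  finally have mass: "h * (\<Sum>j. R (Suc j)) \<le> 1"
    using \<open>0 < h\<close> by (simp add: field_simps)
  obtain L where L: "L-lipschitz_on {..<0} X\<^sub>p"
    using past_lipschitz by blast
  have regular: "summable (\<lambda>j. (norm (V - X (int n - int (Suc j))))\<^sup>2 * R (Suc j))"
      "continuous_on (cball 0 M) (memory_energy h R X (int n))" for V n
  proof -
    obtain K where "norm (X (int n - int (Suc j))) \<le> K * (1 + real (Suc j) * h)" for j
      using memory_scheme_growth[OF L \<open>0 < h\<close>] unfolding X_eq by blast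
    then show "summable (\<lambda>j. (norm (V - X (int n - int (Suc j))))\<^sup>2 * R (Suc j))"
        "continuous_on (cball 0 M) (memory_energy h R X (int n))"
      by (rule memory_energy_summable[OF nonneg moment _ \<open>0 < h\<close>])+
  qed
  have C: "C h n \<noteq> {}" "closed (C h n)" "C h n \<subseteq> cball 0 M" "bounded (C h n)" for n
    using constraint_sets \<open>0 < h\<close> bounded_subset[OF bounded_cball] by blast+
  have argmin: "X (int n) = arg_min_on (memory_energy h R X (int n)) (C h n)" for n
    unfolding X_eq by (subst memory_scheme.simps) simp
  have "compact (C h n)" for n
    using C by (simp add: compact_eq_bounded_closed)
  then have X: "X (int n) \<in> C h n"
      "W \<in> C h n \<Longrightarrow> memory_energy h R X (int n) (X (int n)) \<le> memory_energy h R X (int n) W" for n W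
    using arg_min_on_compact[OF _ C(1) continuous_on_subset[OF regular(2) C(3)]] argmin
    by metis+
  define E where "E n = memory_energy h R X (int n) (X (int n))" for n
  define D where "D n = memory_dissipation h R X (int n)" for n
  define c where "c n = (excess (C h n) (C h (Suc n)))\<^sup>2 / h" for n
  have D: "0 \<le> D n" for n
    unfolding D_def using memory_dissipation_nonneg[OF weights_decreasing nonneg \<open>0 < h\<close>] regular(1) .
  have c: "0 \<le> c n" for n
    using \<open>0 < h\<close> by (simp add: c_def)
  \<comment> \<open>\<open>q\<close> is one plus the Young parameter; \<open>N\<close> such factors
    give \<open>exp (2 * h * N)\<close>, at most \<open>exp (2 * T)\<close>.\<close>
  define q where "q = exp (2 * h)"
  have q: "1 + 2 * h \<le> q"
    unfolding q_def by (rule exp_ge_add_one_self)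
  have step: "E (Suc n) \<le> q * (E n - D n + c n)" for n
  proof -
    obtain W where W: "W \<in> C h (Suc n)"
      and dist: "norm (W - X (int n)) \<le> excess (C h n) (C h (Suc n))"
      using norm_le_excess[OF C(4) C(2) C(1) X(1)] by metis
    have "E (Suc n) \<le> memory_energy h R X (int (Suc n)) W"
      unfolding E_def using W by (rule X(2))
    also have "\<dots> \<le> (1 + (q - 1)) * memory_energy h R X (int (Suc n)) (X (int n))
        + (1 + 1 / (q - 1)) / 2 * (norm (W - X (int n)))\<^sup>2"
      using q \<open>0 < h\<close> by (intro memory_energy_perturb nonneg mass regular \<open>summable R\<close>) auto
    also have "memory_energy h R X (int (Suc n)) (X (int n)) = E n - D n"
      unfolding E_def D_def using memory_energy_shift[OF weights_decreasing nonneg regular(1), of h n]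
      by (simp add: add.commute)
    \<comment> \<open>\<open>h * c n\<close> is the squared excess. The left constant equals
      \<open>q / (2 * (q - 1))\<close>, and \<open>2 * (q - 1) \<ge> 4 * h \<ge> h\<close>; pulling
      out \<open>q\<close> gives the form required by the Gronwall lemma.\<close>
    also have "(1 + 1 / (q - 1)) / 2 * (norm (W - X (int n)))\<^sup>2 \<le> q / h * (h * c n)"
    proof (rule mult_mono)
      have "(1 + 1 / (q - 1)) / 2 = q * (1 / (2 * (q - 1)))"
        using q \<open>0 < h\<close> by (simp add: field_simps)
      also have "\<dots> \<le> q * (1 / h)"
        using q \<open>0 < h\<close> by (intro mult_left_mono divide_left_mono) auto
      finally show "(1 + 1 / (q - 1)) / 2 \<le> q / h"
        by simp
      show "(norm (W - X (int n)))\<^sup>2 \<le> h * c n"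
        using dist \<open>0 < h\<close> by (simp add: c_def power_mono)
    qed (use q \<open>0 < h\<close> in auto)
    finally show ?thesis
      using \<open>0 < h\<close> by (simp add: distrib_left)
  qed
  \<comment> \<open>This sign is used when \<open>q ^ N\<close> is replaced by the larger
    \<open>exp (2 * T)\<close>.\<close>
  have "0 \<le> E 0"
    unfolding E_def memory_energy_def using nonneg \<open>0 < h\<close>
    by (intro mult_nonneg_nonneg suminf_nonneg regular(1)) auto
  have "real N \<le> T / h"
    using \<open>0 < T\<close> \<open>0 < h\<close> unfolding N_eq by simp
  then have "q ^ N \<le> exp (2 * T)"
    unfolding q_def exp_of_nat_mult[symmetric] using \<open>0 < h\<close> by (simp add: field_simps)
  have "E N + (\<Sum>n<N. D n) \<le> q ^ N * (E 0 + (\<Sum>n<N. c n))"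
    using q \<open>0 < h\<close> by (intro discrete_gronwall_dissipation step D c) auto
  also have "\<dots> \<le> exp (2 * T) * (E 0 + (\<Sum>n<N. c n))"
    using \<open>q ^ N \<le> exp (2 * T)\<close> \<open>0 \<le> E 0\<close> c by (intro mult_right_mono) (auto intro: add_nonneg_nonneg sum_nonneg)
  finally show ?thesis
    using D unfolding E_def D_def c_def by (simp add: distrib_left)
qed

end
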